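(* Every pairwise linked lobster is graceful.
   Context: A graph $G=(V,E)$ with $m$ edges is graceful if there is an injective $f:V\to\{0,\ldots,m\}$ (a graceful labeling) with the edge labels $|f(u)-f(v)|$, $uv\in E$, pairwise distinct. A lobster is a tree whose base (the tree obtained by deleting all degree-one vertices) is a caterpillar, a caterpillar being a tree whose base is a path. A lobster $L$ is described by a spine, a path $(v_1,\ldots,v_r)$, together with, for each $i$, a tree $F_i$ (the lobe at $v_i$), the lobes pairwise vertex-disjoint and each meeting the spine only in $v_i$, with $L$ the union of the spine and the lobes; each lobe $F_i$ consists of $v_i$, vertices $u_{i1},\ldots,u_{is_i}$ ($s_i\ge 0$) adjacent to $v_i$, and for each $j$ some $k_{ij}\ge0$ further vertices adjacent only to $u_{ij}$. If $k_{ij}=0$, $u_{ij}$ is a pendant vertex at $v_i$; the reduced lobe $F'_i$ is $F_i$ with all pendant vertices at $v_i$ deleted. For two vertex-disjoint graceful graphs $G_1,G_2$ with given graceful labelings, $G_1\circ G_2$ denotes the graph obtained by identifying the maximum-labeled vertex of $G_1$ with the maximum-labeled vertex of $G_2$. $L$ is pairwise linked if there are trees $G_1,\ldots,G_r$ of diameter $4$, each with a graceful labeling in which its central vertex has the maximum label, such that $F'_i\cong G_i\circ G_{i+1}$ for each $i=1,\ldots,r-1$ and $F'_r\cong G_r$. *)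

theory Defs
  imports Main
begin

definition graph :: "'a set \<Rightarrow> 'a set set \<Rightarrow> bool" where
  "graph V E \<longleftrightarrow> finite V \<and> (\<forall>e\<in>E. \<exists>u v. e = {u, v} \<and> u \<noteq> v \<and> u \<in> V \<and> v \<in> V)"

definition deg :: "'a set set \<Rightarrow> 'a \<Rightarrow> nat" where
  "deg E v = card {e \<in> E. v \<in> e}"

definition walk :: "'a set \<Rightarrow> 'a set set \<Rightarrow> 'a list \<Rightarrow> bool" where
  "walk V E xs \<longleftrightarrow> xs \<noteq> [] \<and> set xs \<subseteq> V \<and>
     (\<forall>i. Suc i < length xs \<longrightarrow> {xs ! i, xs ! Suc i} \<in> E)"

definition connected_graph :: "'a set \<Rightarrow> 'a set set \<Rightarrow> bool" where
  "connected_graph V E \<longleftrightarrow>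
     (\<forall>u\<in>V. \<forall>v\<in>V. \<exists>xs. walk V E xs \<and> hd xs = u \<and> last xs = v)"

definition is_cycle :: "'a set \<Rightarrow> 'a set set \<Rightarrow> 'a list \<Rightarrow> bool" where
  "is_cycle V E xs \<longleftrightarrow> walk V E xs \<and> length xs \<ge> 3 \<and> distinct xs \<and> {last xs, hd xs} \<in> E"

definition tree :: "'a set \<Rightarrow> 'a set set \<Rightarrow> bool" where
  "tree V E \<longleftrightarrow> graph V E \<and> V \<noteq> {} \<and> connected_graph V E \<and> (\<nexists>xs. is_cycle V E xs)"

definition gdist :: "'a set \<Rightarrow> 'a set set \<Rightarrow> 'a \<Rightarrow> 'a \<Rightarrow> nat" where
  "gdist V E u v = (LEAST n. \<exists>xs. walk V E xs \<and> hd xs = u \<and> last xs = v \<and> length xs = Suc n)"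

definition diameter :: "'a set \<Rightarrow> 'a set set \<Rightarrow> nat" where
  "diameter V E = Max {gdist V E u v | u v. u \<in> V \<and> v \<in> V}"

definition ecc :: "'a set \<Rightarrow> 'a set set \<Rightarrow> 'a \<Rightarrow> nat" where
  "ecc V E u = Max {gdist V E u v | v. v \<in> V}"

definition central :: "'a set \<Rightarrow> 'a set set \<Rightarrow> 'a \<Rightarrow> bool" where
  "central V E c \<longleftrightarrow> c \<in> V \<and> ecc V E c = Min (ecc V E ` V)"

definition path_graph :: "'a set \<Rightarrow> 'a set set \<Rightarrow> bool" where
  "path_graph V E \<longleftrightarrow> (\<exists>xs. distinct xs \<and> set xs = V \<and>
      E = {{xs ! i, xs ! Suc i} | i. Suc i < length xs})"

definition base_V :: "'a set \<Rightarrow> 'a set set \<Rightarrow> 'a set" where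
  "base_V V E = {v \<in> V. deg E v \<noteq> 1}"

definition base_E :: "'a set \<Rightarrow> 'a set set \<Rightarrow> 'a set set" where
  "base_E V E = {e \<in> E. e \<subseteq> base_V V E}"

definition caterpillar :: "'a set \<Rightarrow> 'a set set \<Rightarrow> bool" where
  "caterpillar V E \<longleftrightarrow> tree V E \<and> path_graph (base_V V E) (base_E V E)"

definition lobster :: "'a set \<Rightarrow> 'a set set \<Rightarrow> bool" where
  "lobster V E \<longleftrightarrow> tree V E \<and> caterpillar (base_V V E) (base_E V E)"

definition edge_label :: "('a \<Rightarrow> nat) \<Rightarrow> 'a set \<Rightarrow> nat" where
  "edge_label f e = Max (f ` e) - Min (f ` e)"

definition graceful_labeling :: "'a set \<Rightarrow> 'a set set \<Rightarrow> ('a \<Rightarrow> nat) \<Rightarrow> bool" where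
  "graceful_labeling V E f \<longleftrightarrow> inj_on f V \<and> (\<forall>v\<in>V. f v \<le> card E) \<and> inj_on (edge_label f) E"

definition graceful :: "'a set \<Rightarrow> 'a set set \<Rightarrow> bool" where
  "graceful V E \<longleftrightarrow> (\<exists>f. graceful_labeling V E f)"

definition graph_iso :: "'a set \<Rightarrow> 'a set set \<Rightarrow> 'b set \<Rightarrow> 'b set set \<Rightarrow> bool" where
  "graph_iso V1 E1 V2 E2 \<longleftrightarrow> (\<exists>h. bij_betw h V1 V2 \<and>
      (\<forall>u\<in>V1. \<forall>v\<in>V1. {u, v} \<in> E1 \<longleftrightarrow> {h u, h v} \<in> E2))"

definition max_vertex :: "'a set \<Rightarrow> ('a \<Rightarrow> nat) \<Rightarrow> 'a" where
  "max_vertex V f = (THE v. v \<in> V \<and> f v = Max (f ` V))"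

text \<open>Disjoint union (via the sum type) of G1 and G2, with the maximum-labelled
  vertex of G2 identified with the maximum-labelled vertex of G1.\<close>
definition glue_map :: "'a set \<Rightarrow> ('a \<Rightarrow> nat) \<Rightarrow> 'a set \<Rightarrow> ('a \<Rightarrow> nat) \<Rightarrow> 'a \<Rightarrow> 'a + 'a" where
  "glue_map V1 f1 V2 f2 v = (if v = max_vertex V2 f2 then Inl (max_vertex V1 f1) else Inr v)"

definition circ_V :: "'a set \<Rightarrow> ('a \<Rightarrow> nat) \<Rightarrow> 'a set \<Rightarrow> ('a \<Rightarrow> nat) \<Rightarrow> ('a + 'a) set" where
  "circ_V V1 f1 V2 f2 = Inl ` V1 \<union> glue_map V1 f1 V2 f2 ` V2"

definition circ_E :: "'a set \<Rightarrow> 'a set set \<Rightarrow> ('a \<Rightarrow> nat) \<Rightarrow> 'a set \<Rightarrow> 'a set set \<Rightarrow> ('a \<Rightarrow> nat)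
    \<Rightarrow> ('a + 'a) set set" where
  "circ_E V1 E1 f1 V2 E2 f2 = (\<lambda>e. Inl ` e) ` E1 \<union> (\<lambda>e. glue_map V1 f1 V2 f2 ` e) ` E2"

text \<open>Spine vs = [v_1,...,v_r] (0-indexed here), lobes F i = (vertex set, edge set) for i < r.
  Each lobe is a tree rooted at its spine vertex of height at most 2, which is exactly the
  described shape (v_i, neighbours u_ij, and further vertices adjacent only to u_ij).\<close>
definition lobster_description ::
  "'a set \<Rightarrow> 'a set set \<Rightarrow> 'a list \<Rightarrow> (nat \<Rightarrow> 'a set \<times> 'a set set) \<Rightarrow> bool" where
  "lobster_description V E vs F \<longleftrightarrow>
     vs \<noteq> [] \<and> distinct vs \<and> (\<forall>i. Suc i < length vs \<longrightarrow> {vs ! i, vs ! Suc i} \<in> E) \<and>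
     (\<forall>i < length vs. tree (fst (F i)) (snd (F i)) \<and> vs ! i \<in> fst (F i) \<and>
        (\<forall>x \<in> fst (F i). gdist (fst (F i)) (snd (F i)) (vs ! i) x \<le> 2) \<and>
        fst (F i) \<inter> set vs = {vs ! i}) \<and>
     (\<forall>i < length vs. \<forall>j < length vs. i \<noteq> j \<longrightarrow> fst (F i) \<inter> fst (F j) = {}) \<and>
     V = set vs \<union> (\<Union>i < length vs. fst (F i)) \<and>
     E = {{vs ! i, vs ! Suc i} | i. Suc i < length vs} \<union> (\<Union>i < length vs. snd (F i))"

definition pendants_at :: "'a set \<Rightarrow> 'a set set \<Rightarrow> 'a \<Rightarrow> 'a set" where
  "pendants_at V E v = {u \<in> V. {v, u} \<in> E \<and> deg E u = 1}"

definition reduced_V :: "'a set \<Rightarrow> 'a set set \<Rightarrow> 'a \<Rightarrow> 'a set" where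
  "reduced_V V E v = V - pendants_at V E v"

definition reduced_E :: "'a set \<Rightarrow> 'a set set \<Rightarrow> 'a \<Rightarrow> 'a set set" where
  "reduced_E V E v = {e \<in> E. e \<inter> pendants_at V E v = {}}"

text \<open>The trees G_i are represented on vertex type nat (no loss: they are finite).\<close>
definition pairwise_linked :: "'a set \<Rightarrow> 'a set set \<Rightarrow> bool" where
  "pairwise_linked V E \<longleftrightarrow>
     (\<exists>vs F. lobster_description V E vs F \<and>
       (\<exists>(G :: nat \<Rightarrow> nat set \<times> nat set set) (g :: nat \<Rightarrow> nat \<Rightarrow> nat).
          (\<forall>i < length vs.
             tree (fst (G i)) (snd (G i)) \<and> diameter (fst (G i)) (snd (G i)) = 4 \<and>
             graceful_labeling (fst (G i)) (snd (G i)) (g i) \<and>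
             (\<forall>c. central (fst (G i)) (snd (G i)) c \<longrightarrow> g i c = Max (g i ` fst (G i)))) \<and>
          (\<forall>i. Suc i < length vs \<longrightarrow>
             graph_iso (reduced_V (fst (F i)) (snd (F i)) (vs ! i))
                       (reduced_E (fst (F i)) (snd (F i)) (vs ! i))
                       (circ_V (fst (G i)) (g i) (fst (G (Suc i))) (g (Suc i)))
                       (circ_E (fst (G i)) (snd (G i)) (g i) (fst (G (Suc i))) (snd (G (Suc i))) (g (Suc i)))) \<and>
          (let k = length vs - 1 in
             graph_iso (reduced_V (fst (F k)) (snd (F k)) (vs ! k))
                       (reduced_E (fst (F k)) (snd (F k)) (vs ! k))
                       (fst (G k)) (snd (G k)))))"

end

theory Submission
  imports Defs
begin

text \<open>Induct along the spine, keeping the maximum label n on the current spine vertex w. A pendant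
  vertex at w is added by shifting all labels up by one and giving it label 0. To advance, let G have m edges
  and a graceful labeling g with label m at its root, and let A be the colour class of the root and B the other
  one. Glue one copy of G to w, labelled g on A and g + m + n + 1 on B, attach a second copy by joining its
  root to w, labelled g + m + n + 1 on A and g on B, and replace the old labels f by m + n - f. The two
  copies of an edge of G carry the labels n + m + 1 + s and n + m + 1 - s, where |s| is its label in G; the
  joining edge carries n + m + 1, and the new root carries the new maximum.\<close>

section \<open>Edge labels and simple graphs\<close>

lemma edge_label_pair:
  "edge_label f {u, v} = (if f u \<le> f v then f v - f u else f u - f v)"
  by (auto simp: edge_label_def max_def min_def)

lemma edge_label_image: "edge_label f (h ` e) = edge_label (f \<circ> h) e"
  by (simp add: edge_label_def image_comp)

lemma edge_label_cong: "(\<And>x. x \<in> e \<Longrightarrow> f x = g x) \<Longrightarrow> edge_label f e = edge_label g e"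
  by (simp add: edge_label_def cong: image_cong)

lemma graph_edgeE:
  assumes "graph V E" "e \<in> E"
  obtains u v where "e = {u, v}" "u \<noteq> v" "u \<in> V" "v \<in> V"
  using assms unfolding graph_def by blast

lemma graph_edge_subset: "graph V E \<Longrightarrow> e \<in> E \<Longrightarrow> e \<subseteq> V"
  by (auto elim: graph_edgeE)

lemma graph_no_loop: "graph V E \<Longrightarrow> {u, u} \<notin> E"
  by (metis doubleton_eq_iff graph_edgeE)

lemma graph_pairD: "graph V E \<Longrightarrow> {u, v} \<in> E \<Longrightarrow> u \<in> V \<and> v \<in> V \<and> u \<noteq> v"
  using graph_edge_subset graph_no_loop by fastforce

lemma graph_finite_edges: "graph V E \<Longrightarrow> finite E"
  by (meson PowI finite_Pow_iff finite_subset graph_def graph_edge_subset subsetI)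

lemma graph_image:
  assumes "graph V E" "inj_on h V"
  shows "graph (h ` V) ((`) h ` E)"
  unfolding graph_def
proof (intro conjI ballI)
  show "finite (h ` V)" using assms(1) by (simp add: graph_def)
  fix e assume "e \<in> (`) h ` E"
  then obtain d where "d \<in> E" and e: "e = h ` d" by blast
  then obtain u v where "d = {u, v}" "u \<noteq> v" "u \<in> V" "v \<in> V"
    using assms(1) by (meson graph_edgeE)
  then show "\<exists>u v. e = {u, v} \<and> u \<noteq> v \<and> u \<in> h ` V \<and> v \<in> h ` V"
    using e inj_on_eq_iff[OF assms(2)] by (intro exI[of _ "h u"] exI[of _ "h v"]) simp
qed

lemma graph_Un: "graph V E \<Longrightarrow> graph W D \<Longrightarrow> graph (V \<union> W) (E \<union> D)"
  unfolding graph_def by (auto 0 4)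

lemma graph_insert_edge:
  "graph V E \<Longrightarrow> u \<in> V \<Longrightarrow> v \<in> V \<Longrightarrow> u \<noteq> v \<Longrightarrow> graph V (insert {u, v} E)"
  unfolding graph_def by blast

subsection \<open>Graceful labelings with the maximum at a prescribed vertex\<close>

text \<open>The invariant of the construction. The bijection onto \<open>{1..n}\<close> forces
  \<open>n\<close> to be the number of edges, and \<open>w\<close> is the vertex at which the graph
  will be extended next.\<close>

definition top_graceful :: "'a set \<Rightarrow> 'a set set \<Rightarrow> 'a \<Rightarrow> ('a \<Rightarrow> nat) \<Rightarrow> nat \<Rightarrow> bool" where
  "top_graceful V E w f n \<longleftrightarrow> graph V E \<and> inj_on f V \<and> (\<forall>v\<in>V. f v \<le> n) \<and>
     bij_betw (edge_label f) E {1..n} \<and> w \<in> V \<and> f w = n"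

lemma top_graceful_imp_graceful:
  assumes "top_graceful V E w f n"
  shows "graceful V E"
proof -
  have "card E = n"
    using assms bij_betw_same_card unfolding top_graceful_def by fastforce
  then show ?thesis
    using assms unfolding top_graceful_def graceful_def graceful_labeling_def bij_betw_def by blast
qed

text \<open>Injectivity of \<open>f\<close> on vertices rules out the edge label 0, so the distinct
  edge labels are \<open>card E\<close> values inside \<open>{1..card E}\<close> and must exhaust
  it.\<close>

lemma graceful_labeling_bij_betw:
  assumes "graph V E" "graceful_labeling V E f"
  shows "bij_betw (edge_label f) E {1..card E}"
proof -
  have f: "inj_on f V" "\<And>v. v \<in> V \<Longrightarrow> f v \<le> card E" and inj: "inj_on (edge_label f) E"
    using assms(2) by (auto simp: graceful_labeling_def)
  have "edge_label f e \<in> {1..card E}" if e: "e \<in> E" for e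
  proof -
    obtain u v where uv: "e = {u, v}" "u \<noteq> v" "u \<in> V" "v \<in> V"
      using assms(1) e by (meson graph_edgeE)
    have "f u \<noteq> f v" using f(1) uv by (auto dest: inj_onD)
    then show ?thesis using f(2)[OF uv(3)] f(2)[OF uv(4)] uv(1) by (auto simp: edge_label_pair)
  qed
  then have "edge_label f ` E \<subseteq> {1..card E}" by blast
  moreover have "card (edge_label f ` E) = card {1..card E}"
    using inj by (simp add: card_image)
  ultimately have "edge_label f ` E = {1..card E}" by (simp add: card_subset_eq)
  then show ?thesis using inj by (simp add: bij_betw_def)
qed

text \<open>The edge label \<open>card E\<close> can only be the difference of the vertex labels
  \<open>card E\<close> and 0, so the largest admissible label is really used;
  \<open>max_vertex\<close> then picks its unique carrier.\<close>

lemma graceful_labeling_top: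
  assumes "graph V E" "graceful_labeling V E f" "V \<noteq> {}"
  shows "top_graceful V E (max_vertex V f) f (card E)"
proof -
  let ?m = "card E"
  have f: "inj_on f V" "\<And>v. v \<in> V \<Longrightarrow> f v \<le> ?m"
    using assms(2) by (auto simp: graceful_labeling_def)
  have bij: "bij_betw (edge_label f) E {1..?m}"
    using assms by (intro graceful_labeling_bij_betw)
  have "\<exists>v\<in>V. f v = ?m"
  \<comment> \<open>Without edges there is no edge label to look at, but then every vertex label is
    0, which is \<open>card E\<close>.\<close>
  proof (cases "?m = 0")
    case True
    then show ?thesis using f(2) assms(3) by fastforce
  next
    case False
    then have "?m \<in> edge_label f ` E" using bij by (simp add: bij_betw_def)
    then obtain e where e: "e \<in> E" "edge_label f e = ?m" by force
    then obtain u v where uv: "e = {u, v}" "u \<in> V" "v \<in> V"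
      using assms(1) by (meson graph_edgeE)
    have "f u = ?m \<or> f v = ?m"
      using e(2) f(2)[OF uv(2)] f(2)[OF uv(3)] uv(1) by (auto simp: edge_label_pair split: if_splits)
    then show ?thesis using uv by blast
  qed
  then obtain v where v: "v \<in> V" "f v = ?m" by blast
  have Max: "Max (f ` V) = ?m"
    using assms(1) f(2) v by (intro Max_eqI) (auto simp: graph_def intro: rev_image_eqI)
  have "max_vertex V f = v"
    unfolding max_vertex_def Max using v inj_onD[OF f(1)] by (intro the_equality) auto
  then show ?thesis using assms(1) f bij v by (simp add: top_graceful_def)
qed

text \<open>Labels are pulled back along the inverse of \<open>h\<close>. This starts the induction,
  by moving the first linked tree into its lobe.\<close>

lemma top_graceful_image:
  assumes "top_graceful V E w f n" "inj_on h V"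
  shows "\<exists>f'. top_graceful (h ` V) ((`) h ` E) (h w) f' n"
proof -
  let ?k = "inv_into V h" and ?f = "f \<circ> inv_into V h"
  have E: "\<And>e. e \<in> E \<Longrightarrow> e \<subseteq> V" and gr: "graph V E" and inj: "inj_on f V"
    using assms graph_edge_subset by (auto simp: top_graceful_def)
  have kh: "?k (h x) = x" if "x \<in> V" for x using that assms(2) by simp
  have lab: "edge_label ?f (h ` e) = edge_label f e" if "e \<in> E" for e
    unfolding edge_label_image by (rule edge_label_cong) (use kh E[OF that] in auto)
  have inj_im: "inj_on ((`) h) E"
    using assms(2) E by (meson inj_on_def inj_on_image_eq_iff)
  have "bij_betw (edge_label ?f \<circ> (`) h) E {1..n}"
    using assms(1) lab by (auto simp: top_graceful_def cong: bij_betw_cong)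
  then have "bij_betw (edge_label ?f) ((`) h ` E) {1..n}"
    using inj_im by (simp add: bij_betw_comp_iff[OF inj_on_imp_bij_betw[OF inj_im]])
  moreover have "inj_on ?f (h ` V)"
    using inj kh by (auto simp: inj_on_def)
  ultimately show ?thesis
    using assms graph_image[OF gr assms(2)] kh by (intro exI[of _ ?f]) (auto simp: top_graceful_def)
qed

lemma top_graceful_add_pendant:
  assumes "top_graceful V E w f n" "p \<notin> V"
  shows "\<exists>f'. top_graceful (insert p V) (insert {w, p} E) w f' (Suc n)"
proof -
  let ?f = "\<lambda>x. if x = p then 0 else Suc (f x)"
  have gr: "graph V E" and inj: "inj_on f V" and bij: "bij_betw (edge_label f) E {1..n}"
    and w: "w \<in> V" "f w = n" using assms by (auto simp: top_graceful_def)
  have "graph (insert p V) E" using gr unfolding graph_def by blast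
  then have gr': "graph (insert p V) (insert {w, p} E)"
    using assms w by (intro graph_insert_edge) auto
  have "edge_label ?f e = edge_label f e" if e: "e \<in> E" for e
  proof -
    obtain u v where "e = {u, v}" "u \<in> V" "v \<in> V" using gr e by (meson graph_edgeE)
    then show ?thesis using assms(2) by (auto simp: edge_label_pair)
  qed
  then have "bij_betw (edge_label ?f) E {1..n}" using bij by (simp cong: bij_betw_cong)
  moreover have "bij_betw (edge_label ?f) {{w, p}} {Suc n}"
    using w assms(2) by (auto simp: bij_betw_def edge_label_pair)
  ultimately have "bij_betw (edge_label ?f) (E \<union> {{w, p}}) ({1..n} \<union> {Suc n})"
    by (rule bij_betw_combine) auto
  moreover have "{1..n} \<union> {Suc n} = {1..Suc n}" by auto
  ultimately have "bij_betw (edge_label ?f) (insert {w, p} E) {1..Suc n}" by simp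
  moreover have "inj_on ?f (insert p V)" using inj assms(2) by (auto simp: inj_on_def)
  ultimately show ?thesis
    using assms gr' w by (intro exI[of _ ?f]) (auto simp: top_graceful_def)
qed

lemma top_graceful_add_pendants:
  assumes "finite P" "\<exists>f n. top_graceful V E w f n" "P \<inter> V = {}"
  shows "\<exists>f n. top_graceful (V \<union> P) (E \<union> (\<lambda>p. {w, p}) ` P) w f n"
  using assms
proof (induction P)
  case (insert p P)
  then obtain f n where "top_graceful (V \<union> P) (E \<union> (\<lambda>p. {w, p}) ` P) w f n" by auto
  from top_graceful_add_pendant[OF this, of p] insert show ?case by auto
qed simp

text \<open>The step along the spine. \<open>h1\<close> lays a copy of the tree on the old graph so
  that only \<open>w\<close> is shared, \<open>h2\<close> gives a copy away from everything, and
  \<open>B\<close> is the colour class not containing the root \<open>c\<close>. The top label moves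
  from \<open>w\<close> to \<open>h2 c\<close>.\<close>

lemma top_graceful_link_copies:
  assumes H: "top_graceful VH EH w f n" and G: "top_graceful VG EG c g m"
    and bip: "\<And>e. e \<in> EG \<Longrightarrow> \<exists>a b. e = {a, b} \<and> a \<notin> B \<and> b \<in> B" and c: "c \<notin> B"
    and h1: "inj_on h1 VG" "h1 c = w" "h1 ` VG \<inter> VH = {w}"
    and h2: "inj_on h2 VG" "h2 ` VG \<inter> (VH \<union> h1 ` VG) = {}"
  shows "\<exists>f' n'. top_graceful (VH \<union> h1 ` VG \<union> h2 ` VG)
    (EH \<union> (`) h1 ` EG \<union> (`) h2 ` EG \<union> {{w, h2 c}}) (h2 c) f' n'"
proof -
  \<comment> \<open>The number of edges: \<open>n\<close> old ones, \<open>m\<close> in each copy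
    and the joining edge. It is also the label \<open>m + (m + n + 1)\<close> of the new
    root.\<close>
  let ?N = "n + 2 * m + 1"
  let ?V = "VH \<union> h1 ` VG \<union> h2 ` VG"
  let ?E = "EH \<union> (`) h1 ` EG \<union> (`) h2 ` EG \<union> {{w, h2 c}}"
  define F1 where "F1 y = (if y \<in> B then g y + m + n + 1 else g y)" for y
  define F2 where "F2 y = (if y \<in> B then g y else g y + m + n + 1)" for y
  \<comment> \<open>Both descriptions apply at the shared vertex \<open>w = h1 c\<close> and agree
    there: \<open>m + (n - n) = m = g c\<close>, with \<open>c\<close> outside
    \<open>B\<close>.\<close>
  define F where "F x = (if x \<in> VH then m + (n - f x) else if x \<in> h1 ` VG then F1 (inv_into VG h1 x)
    else F2 (inv_into VG h2 x))" for x
  have grH: "graph VH EH" and f: "inj_on f VH" "\<And>v. v \<in> VH \<Longrightarrow> f v \<le> n"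
    and bijH: "bij_betw (edge_label f) EH {1..n}" and w: "w \<in> VH" "f w = n"
    using H by (auto simp: top_graceful_def)
  have grG: "graph VG EG" and g: "inj_on g VG" "\<And>v. v \<in> VG \<Longrightarrow> g v \<le> m"
    and bijG: "bij_betw (edge_label g) EG {1..m}" and cG: "c \<in> VG" "g c = m"
    using G by (auto simp: top_graceful_def)
  have FH: "F x = m + (n - f x)" if "x \<in> VH" for x using that by (simp add: F_def)
  have Fh1: "F (h1 y) = F1 y" if "y \<in> VG" for y
  proof (cases "h1 y \<in> VH")
    case True
    then have "h1 y = h1 c" using h1 that by blast
    then have "y = c" using h1(1) that cG by (auto dest: inj_onD)
    then show ?thesis using h1 w c cG by (simp add: F_def F1_def)
  next
    case False
    then show ?thesis using h1(1) that by (simp add: F_def)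
  qed
  have Fh2: "F (h2 y) = F2 y" if "y \<in> VG" for y
  proof -
    have "h2 y \<notin> VH" "h2 y \<notin> h1 ` VG" using h2(2) that by auto
    then show ?thesis using h2(1) that by (simp add: F_def)
  qed
  have Fh2c: "F (h2 c) = ?N" using Fh2[OF cG(1)] c cG by (simp add: F2_def)
  have Fw: "F w = m" using FH w by simp
  have gD: "x = y" if "x \<in> VG" "y \<in> VG" "g x = g y" for x y
    using g(1) that by (auto dest: inj_onD)
  have gc: "g x < m" if "x \<in> VG" "x \<noteq> c" for x
    using g(2)[OF that(1)] gD[OF that(1) cG(1)] that cG by fastforce
  \<comment> \<open>The difference \<open>g b - g a\<close> enters with opposite signs, so the two
    labels lie symmetrically about \<open>n + m + 1\<close>. Adding before subtracting keeps the
    natural-number subtraction from truncating, since \<open>g\<close> is at most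
    \<open>m\<close>.\<close>
  have lab1: "edge_label F (h1 ` {a, b}) = n + m + 1 + g b - g a"
    and lab2: "edge_label F (h2 ` {a, b}) = n + m + 1 + g a - g b"
    if "{a, b} \<in> EG" "a \<notin> B" "b \<in> B" for a b
  proof -
    have ab: "a \<in> VG" "b \<in> VG" using graph_pairD[OF grG that(1)] by auto
    show "edge_label F (h1 ` {a, b}) = n + m + 1 + g b - g a"
      using ab that g(2)[OF ab(1)] g(2)[OF ab(2)]
      by (simp add: edge_label_pair Fh1 F1_def)
    show "edge_label F (h2 ` {a, b}) = n + m + 1 + g a - g b"
      using ab that g(2)[OF ab(1)] g(2)[OF ab(2)]
      by (simp add: edge_label_pair Fh2 F2_def)
  qed
  have "edge_label F e = edge_label f e" if e: "e \<in> EH" for e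
  proof -
    obtain u v where "e = {u, v}" "u \<in> VH" "v \<in> VH" using grH e by (meson graph_edgeE)
    then show ?thesis using f(2)[of u] f(2)[of v] by (auto simp: edge_label_pair FH)
  qed
  then have bij1: "bij_betw (edge_label F) EH {1..n}" using bijH by (simp cong: bij_betw_cong)
  have bij2: "bij_betw (edge_label F) {{w, h2 c}} {n + m + 1}"
    using Fw Fh2c by (auto simp: bij_betw_def edge_label_pair)
  \<comment> \<open>\<open>?M\<close> holds the labels left for the two copies: those above
    \<open>n\<close>, except the middle one, which the joining edge takes.\<close>
  let ?D = "(`) h1 ` EG \<union> (`) h2 ` EG" and ?M = "{n + 1..?N} - {n + m + 1}"
  have cards: "card EG = m" using bij_betw_same_card[OF bijG] by simp
  have edge: "\<exists>a b. e = {a, b} \<and> a \<notin> B \<and> b \<in> B \<and> g a \<le> m \<and> g b \<le> m \<and> g a \<noteq> g b"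
    if e: "e \<in> EG" for e
  proof -
    obtain a b where ab: "e = {a, b}" "a \<notin> B" "b \<in> B" using bip e by blast
    then have "a \<in> VG" "b \<in> VG" "a \<noteq> b" using graph_pairD[OF grG] e by auto
    then show ?thesis using ab g gD by blast
  qed
  have sub: "edge_label F ` ?D \<subseteq> ?M"
  proof
    fix l assume "l \<in> edge_label F ` ?D"
    then obtain e where e: "e \<in> EG" "l = edge_label F (h1 ` e) \<or> l = edge_label F (h2 ` e)" by blast
    then obtain a b where ab: "e = {a, b}" "a \<notin> B" "b \<in> B" "g a \<le> m" "g b \<le> m" "g a \<noteq> g b"
      using edge by blast
    show "l \<in> ?M" using e(2) ab lab1[of a b] lab2[of a b] e(1) by auto
  qed
  have sup: "?M \<subseteq> edge_label F ` ?D"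
  proof
    fix l assume l: "l \<in> ?M"
    \<comment> \<open>\<open>d\<close> is the distance of \<open>l\<close> from the middle label.
      The edge with label \<open>d\<close> in the tree yields \<open>l\<close> in one of its two
      copies; which one depends on the side of the middle and on the colour of the end with the
      larger label.\<close>
    define d where "d = (if l \<le> n + m then n + m + 1 - l else l - (n + m + 1))"
    have "d \<in> {1..m}" using l by (auto simp: d_def)
    then have "d \<in> edge_label g ` EG" using bijG by (simp add: bij_betw_def)
    then obtain e where e: "e \<in> EG" "edge_label g e = d" by blast
    then obtain a b where ab: "e = {a, b}" "a \<notin> B" "b \<in> B" "g a \<le> m" "g b \<le> m" "g a \<noteq> g b"
      using edge by blast
    have "l = edge_label F (h1 ` e) \<or> l = edge_label F (h2 ` e)"
      using e ab lab1[of a b] lab2[of a b] l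
      by (auto simp: edge_label_pair d_def split: if_splits)
    then show "l \<in> edge_label F ` ?D" using e(1) by blast
  qed
  have finG: "finite EG" using grG by (rule graph_finite_edges)
  have card_M: "card ?M = 2 * m" by (simp add: card_Diff_singleton_if)
  \<comment> \<open>Injectivity comes from counting: at most \<open>2 * m\<close> edges realise all
    \<open>2 * m\<close> labels of \<open>?M\<close>, so no label is repeated.\<close>
  have "card ?D \<le> card ((`) h1 ` EG) + card ((`) h2 ` EG)" by (rule card_Un_le)
  also have "\<dots> \<le> 2 * m" using card_image_le[OF finG, of "(`) h1"]
      card_image_le[OF finG, of "(`) h2"] cards by simp
  finally have "card ?D \<le> card (edge_label F ` ?D)" using sub sup card_M by (metis subset_antisym)
  then have "inj_on (edge_label F) ?D"
    using finG by (intro eq_card_imp_inj_on) (auto intro: le_antisym card_image_le)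
  then have bij3: "bij_betw (edge_label F) ?D ?M" using sub sup by (auto simp: bij_betw_def)
  have "bij_betw (edge_label F) (EH \<union> ?D) ({1..n} \<union> ?M)"
    by (rule bij_betw_combine[OF bij1 bij3]) auto
  then have "bij_betw (edge_label F) (EH \<union> ?D \<union> {{w, h2 c}}) ({1..n} \<union> ?M \<union> {n + m + 1})"
    by (rule bij_betw_combine[OF _ bij2]) auto
  moreover have "EH \<union> ?D \<union> {{w, h2 c}} = ?E" by auto
  moreover have "{1..n} \<union> ?M \<union> {n + m + 1} = {1..?N}" by auto
  ultimately have bij: "bij_betw (edge_label F) ?E {1..?N}" by metis
  have "h2 c \<notin> VH" using h2(2) cG by blast
  then have "w \<noteq> h2 c" using w by blast
  then have gr: "graph ?V ?E"
    using graph_insert_edge[OF graph_Un[OF graph_Un[OF grH graph_image[OF grG h1(1)]]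
          graph_image[OF grG h2(1)]], of w "h2 c"] w cG by simp
  have le: "F x \<le> ?N" if x: "x \<in> ?V" for x
    using x
  proof (elim UnE)
    assume "x \<in> VH"
    then show ?thesis by (simp add: FH)
  next
    assume "x \<in> h1 ` VG"
    then show ?thesis using g(2) by (fastforce simp: Fh1 F1_def)
  next
    assume "x \<in> h2 ` VG"
    then show ?thesis using g(2) by (fastforce simp: Fh2 F2_def)
  qed
  \<comment> \<open>The old vertices stay in the block from \<open>m\<close> to
    \<open>m + n\<close>. Labels in the copies lie below \<open>m\<close> or above
    \<open>m + n\<close>, except for the value \<open>m\<close> at the root of the first copy, which
    is \<open>w\<close> itself.\<close>
  have rangeH: "m \<le> F x \<and> F x \<le> m + n" if "x \<in> VH" for x using that by (simp add: FH)
  have injH: "inj_on F VH"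
  proof (rule inj_onI)
    fix x y assume "x \<in> VH" "y \<in> VH" "F x = F y"
    then have "f x = f y" using f(2)[of x] f(2)[of y] by (simp add: FH)
    then show "x = y" using f(1) \<open>x \<in> VH\<close> \<open>y \<in> VH\<close> by (auto dest: inj_onD)
  qed
  \<comment> \<open>Equal labels lie in the same outer block, where they determine \<open>g\<close>
    and hence the vertex of the tree. A collision between the copies would thus concern one vertex
    \<open>y\<close>, but the copies put \<open>y\<close> into opposite blocks.\<close>
  have F12: "F1 y = F1 z \<Longrightarrow> y = z" "F2 y = F2 z \<Longrightarrow> y = z" "F1 y = F2 z \<Longrightarrow> y = z"
    "F1 y \<noteq> F2 y" if "y \<in> VG" "z \<in> VG" for y z
    using g(2)[OF that(1)] g(2)[OF that(2)] gD[OF that]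
    by (auto simp: F1_def F2_def split: if_splits)
  have F1H: "y = c" if "y \<in> VG" "x \<in> VH" "F x = F1 y" for x y
    using rangeH[OF that(2)] that(3) gc[OF that(1)] by (force simp: F1_def split: if_splits)
  have F2H: False if "y \<in> VG" "x \<in> VH" "F x = F2 y" for x y
    using rangeH[OF that(2)] that(3) gc[OF that(1)] c by (force simp: F2_def split: if_splits)
  have inj: "inj_on F ?V"
  proof -
    have "inj_on F (h1 ` VG)" by (rule inj_onI) (auto simp: Fh1 dest: F12)
    moreover have "F x \<noteq> F y" if "x \<in> VH - h1 ` VG" "y \<in> h1 ` VG - VH" for x y
      using that F1H h1(2) w by (force simp: Fh1)
    ultimately have "inj_on F (VH \<union> h1 ` VG)" using injH by (subst inj_on_Un) blast
    moreover have "inj_on F (h2 ` VG)" by (rule inj_onI) (auto simp: Fh2 dest: F12)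
    moreover have "F x \<noteq> F y" if x: "x \<in> VH \<union> h1 ` VG" and y: "y \<in> h2 ` VG" for x y
    proof
      assume eq: "F x = F y"
      from y obtain z where z: "z \<in> VG" "y = h2 z" by blast
      then have "F x = F2 z" using eq Fh2 by simp
      then have "x \<notin> VH" using F2H z by blast
      then obtain u where u: "u \<in> VG" "x = h1 u" using x by blast
      then have "F1 u = F2 z" using eq z Fh1 Fh2 by simp
      then show False using F12(3,4) u z by metis
    qed
    ultimately show ?thesis by (subst inj_on_Un) blast
  qed
  show ?thesis
    using gr inj le bij cG Fh2c by (intro exI[of _ F] exI[of _ ?N]) (auto simp: top_graceful_def)
qed

subsection \<open>Distances and centres\<close>

lemma walk_pair: "u \<in> V \<Longrightarrow> v \<in> V \<Longrightarrow> {u, v} \<in> E \<Longrightarrow> walk V E [u, v]"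
  by (auto simp: walk_def)

lemma gdist_le: "walk V E xs \<Longrightarrow> length xs = Suc n \<Longrightarrow> gdist V E (hd xs) (last xs) \<le> n"
  unfolding gdist_def by (rule Least_le) blast

lemma gdist_walk:
  assumes "connected_graph V E" "u \<in> V" "v \<in> V"
  obtains xs where "walk V E xs" "hd xs = u" "last xs = v" "length xs = Suc (gdist V E u v)"
proof -
  obtain xs where xs: "walk V E xs" "hd xs = u" "last xs = v"
    using assms unfolding connected_graph_def by blast
  then have "length xs = Suc (length xs - 1)" by (simp add: walk_def)
  with xs have "\<exists>n xs. walk V E xs \<and> hd xs = u \<and> last xs = v \<and> length xs = Suc n" by blast
  then have "\<exists>xs. walk V E xs \<and> hd xs = u \<and> last xs = v \<and> length xs = Suc (gdist V E u v)"
    unfolding gdist_def by (rule LeastI_ex)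
  then show thesis using that by blast
qed

text \<open>Distance at most 2 in terms of edges alone, which passes through injections and through
  deletion of pendant vertices without any handling of walks.\<close>

definition within2 :: "'a set set \<Rightarrow> 'a \<Rightarrow> 'a \<Rightarrow> bool" where
  "within2 E u v \<longleftrightarrow> u = v \<or> {u, v} \<in> E \<or> (\<exists>z. {u, z} \<in> E \<and> {z, v} \<in> E)"

lemma gdist_le_1D:
  assumes "connected_graph V E" "u \<in> V" "v \<in> V" "gdist V E u v \<le> 1"
  shows "u = v \<or> {u, v} \<in> E"
proof -
  obtain xs where xs: "walk V E xs" "hd xs = u" "last xs = v" "length xs = Suc (gdist V E u v)"
    using assms by (meson gdist_walk)
  then have "length xs = 1 \<or> length xs = 2" using assms(4) by linarith
  then obtain a b where "xs = [a] \<or> xs = [a, b]"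
    by (auto simp: length_Suc_conv numeral_2_eq_2)
  moreover have "{xs ! 0, xs ! Suc 0} \<in> E" if "Suc 0 < length xs"
    using xs(1) that by (simp add: walk_def)
  ultimately show ?thesis using xs by auto
qed

lemma gdist_le_2D:
  assumes "connected_graph V E" "u \<in> V" "v \<in> V" "gdist V E u v \<le> 2"
  shows "within2 E u v"
proof -
  obtain xs where xs: "walk V E xs" "hd xs = u" "last xs = v" "length xs = Suc (gdist V E u v)"
    using assms by (meson gdist_walk)
  then have "length xs = 1 \<or> length xs = 2 \<or> length xs = 3" using assms(4) by linarith
  then obtain a b c where abc: "xs = [a] \<or> xs = [a, b] \<or> xs = [a, b, c]"
    by (auto simp: length_Suc_conv numeral_2_eq_2 numeral_3_eq_3)
  have step: "{xs ! i, xs ! Suc i} \<in> E" if "Suc i < length xs" for i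
    using xs(1) that by (simp add: walk_def)
  show ?thesis using abc xs step[of 0] step[of 1] by (auto simp: within2_def)
qed

lemma within2_gdist_le_2:
  assumes "graph V E" "u \<in> V" "within2 E u v"
  shows "gdist V E u v \<le> 2"
  using assms(3) unfolding within2_def
proof (elim disjE exE conjE)
  assume "u = v"
  then show ?thesis using gdist_le[of V E "[u]" 0] assms(2) by (simp add: walk_def)
next
  assume e: "{u, v} \<in> E"
  then show ?thesis using gdist_le[of V E "[u, v]" 1] graph_pairD[OF assms(1) e] by (simp add: walk_pair)
next
  fix z assume e: "{u, z} \<in> E" "{z, v} \<in> E"
  have "walk V E [u, z, v]"
    using e graph_pairD[OF assms(1) e(1)] graph_pairD[OF assms(1) e(2)]
    by (auto simp: walk_def less_Suc_eq)
  then show ?thesis using gdist_le[of V E "[u, z, v]" 2] by simp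
qed

lemma diameter_attained:
  assumes "finite V" "V \<noteq> {}"
  obtains x y where "x \<in> V" "y \<in> V" "gdist V E x y = diameter V E"
proof -
  have "{gdist V E u v | u v. u \<in> V \<and> v \<in> V} = (\<lambda>(u, v). gdist V E u v) ` (V \<times> V)" by auto
  then have "finite {gdist V E u v | u v. u \<in> V \<and> v \<in> V}" using assms by simp
  moreover have "{gdist V E u v | u v. u \<in> V \<and> v \<in> V} \<noteq> {}" using assms by blast
  ultimately have "diameter V E \<in> {gdist V E u v | u v. u \<in> V \<and> v \<in> V}"
    unfolding diameter_def by (rule Max_in)
  then show thesis using that by auto
qed

text \<open>Any two vertices are equal, adjacent or joined through \<open>c\<close>. In
  contrapositive form this is how the large diameter of the linked trees enters: no vertex is
  adjacent to all others.\<close>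

lemma diameter_star_le_2:
  assumes "graph V E" "c \<in> V" "\<And>v. v \<in> V \<Longrightarrow> v = c \<or> {c, v} \<in> E"
  shows "diameter V E \<le> 2"
proof -
  obtain x y where xy: "x \<in> V" "y \<in> V" "gdist V E x y = diameter V E"
    using assms by (metis diameter_attained empty_iff graph_def)
  have "within2 E x y"
    using assms(3)[OF xy(1)] assms(3)[OF xy(2)] by (auto simp: within2_def insert_commute)
  then show ?thesis using within2_gdist_le_2[OF assms(1) xy(1)] xy(3) by metis
qed

text \<open>A vertex of eccentricity at most 1 would make the graph a star, of diameter at most 2.
  So every eccentricity is at least 2, and \<open>c\<close> attains this minimum.\<close>

lemma central_if_within2:
  assumes "tree V E" "diameter V E > 2" "c \<in> V" "\<And>v. v \<in> V \<Longrightarrow> within2 E c v"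
  shows "central V E c"
proof -
  have gr: "graph V E" and con: "connected_graph V E" using assms(1) by (auto simp: tree_def)
  then have fin: "finite V" by (simp add: graph_def)
  have ecc_fin: "finite {gdist V E u v | v. v \<in> V}" for u using fin by simp
  have le: "ecc V E c \<le> 2"
    unfolding ecc_def using ecc_fin assms(3,4) gr by (subst Max_le_iff) (auto intro: within2_gdist_le_2)
  have ge: "2 \<le> ecc V E u" if u: "u \<in> V" for u
  proof (rule ccontr)
    assume "\<not> 2 \<le> ecc V E u"
    moreover have "gdist V E u v \<le> ecc V E u" if "v \<in> V" for v
      unfolding ecc_def using ecc_fin that by (intro Max_ge) auto
    ultimately have "v = u \<or> {u, v} \<in> E" if "v \<in> V" for v
      using gdist_le_1D[OF con u that] that by force
    then show False using diameter_star_le_2[OF gr u] assms(2) by fastforce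
  qed
  have "Min (ecc V E ` V) = ecc V E c"
    using fin assms(3) le ge by (intro Min_eqI) (auto intro: order_trans)
  then show ?thesis using assms(3) by (simp add: central_def)
qed

text \<open>Two adjacent vertices both in or both outside the neighbourhood of v would close a cycle of
  length 3 or 5.\<close>

lemma tree_height2_bipartite:
  assumes "tree V E" "v \<in> V" "\<And>x. x \<in> V \<Longrightarrow> within2 E v x" "e \<in> E"
  shows "\<exists>a b. e = {a, b} \<and> {v, a} \<notin> E \<and> {v, b} \<in> E"
proof -
  have gr: "graph V E" and nocyc: "\<not> is_cycle V E xs" for xs using assms(1) by (auto simp: tree_def)
  obtain x y where e: "e = {x, y}" "x \<noteq> y" "x \<in> V" "y \<in> V" using gr assms(4) by (meson graph_edgeE)
  have xy: "{x, y} \<in> E" using assms(4) e by simp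
  have tri: False if "{a, b} \<in> E" "{b, d} \<in> E" "{d, a} \<in> E" for a b d
  proof -
    have "is_cycle V E [a, b, d]"
      using that graph_pairD[OF gr that(1)] graph_pairD[OF gr that(2)] graph_pairD[OF gr that(3)]
      by (auto simp: is_cycle_def walk_def less_Suc_eq)
    then show False using nocyc by blast
  qed
  have ex: "\<exists>z. {v, z} \<in> E \<and> {z, t} \<in> E" if "t \<in> V" "t \<noteq> v" "{v, t} \<notin> E" for t
    using assms(3)[OF that(1)] that by (auto simp: within2_def)
  have "\<not> ({v, x} \<in> E \<and> {v, y} \<in> E)" using tri[of v x y] xy by (auto simp: insert_commute)
  moreover have "{v, x} \<in> E \<or> {v, y} \<in> E"
  proof (rule ccontr)
    assume n: "\<not> ({v, x} \<in> E \<or> {v, y} \<in> E)"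
    then have "x \<noteq> v" "y \<noteq> v" using xy by (auto simp: insert_commute)
    then obtain s t where s: "{v, s} \<in> E" "{s, x} \<in> E" and t: "{v, t} \<in> E" "{t, y} \<in> E"
      using ex e n by metis
    \<comment> \<open>If \<open>s\<close> and \<open>t\<close> coincided, \<open>s\<close>,
      \<open>x\<close>, \<open>y\<close> would form a triangle; so the 5-cycle below has no repeated
      vertex.\<close>
    have st: "s \<noteq> t" using tri[of s x y] s t xy by (auto simp: insert_commute)
    have "distinct [v, s, x, y, t]"
      using st n s t \<open>x \<noteq> v\<close> \<open>y \<noteq> v\<close> e graph_pairD[OF gr s(1)] graph_pairD[OF gr s(2)]
        graph_pairD[OF gr t(1)] graph_pairD[OF gr t(2)] by auto
    moreover have "walk V E [v, s, x, y, t]"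
      using assms(2) e xy s t graph_pairD[OF gr s(1)] graph_pairD[OF gr t(1)]
      by (auto simp: walk_def less_Suc_eq insert_commute)
    ultimately have "is_cycle V E [v, s, x, y, t]"
      using t(1) by (simp add: is_cycle_def insert_commute)
    then show False using nocyc by blast
  qed
  ultimately show ?thesis using e(1) by (metis insert_commute)
qed

subsection \<open>Embedding the linked trees into the lobes\<close>

text \<open>The inverse of the isomorphism carries the model into the lobe and presents the edge set
  as an image, the form in which labelings are transported.\<close>

lemma graph_iso_obtain:
  assumes "graph_iso V1 E1 V2 E2" "graph V1 E1" "graph V2 E2"
  obtains k where "bij_betw k V2 V1" "E1 = (`) k ` E2"
proof -
  obtain h where h: "bij_betw h V1 V2" "\<And>u v. u \<in> V1 \<Longrightarrow> v \<in> V1 \<Longrightarrow> {u, v} \<in> E1 \<longleftrightarrow> {h u, h v} \<in> E2"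
    using assms(1) unfolding graph_iso_def by blast
  define k where "k = inv_into V1 h"
  have k: "bij_betw k V2 V1" unfolding k_def using h(1) by (rule bij_betw_inv_into)
  have kh: "k (h u) = u" if "u \<in> V1" for u
    using that h(1) by (simp add: k_def bij_betw_inv_into_left)
  have hk: "h (k u) = u" "k u \<in> V1" if "u \<in> V2" for u
    using that h(1) k by (auto simp: k_def bij_betw_inv_into_right dest: bij_betwE)
  have "E1 \<subseteq> (`) k ` E2"
  proof
    fix e assume e: "e \<in> E1"
    then obtain u v where uv: "e = {u, v}" "u \<in> V1" "v \<in> V1" using assms(2) by (meson graph_edgeE)
    then have "{h u, h v} \<in> E2" using h(2) e by blast
    moreover have "e = k ` {h u, h v}" using uv kh by simp
    ultimately show "e \<in> (`) k ` E2" by blast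
  qed
  moreover have "k ` e \<in> E1" if e: "e \<in> E2" for e
  proof -
    obtain u v where uv: "e = {u, v}" "u \<in> V2" "v \<in> V2" using e assms(3) by (meson graph_edgeE)
    then show ?thesis using h(2)[of "k u" "k v"] hk e by simp
  qed
  ultimately have "E1 = (`) k ` E2" by blast
  then show thesis by (rule that[OF k])
qed

text \<open>By injectivity, an edge of the image at \<open>k s\<close> comes from an edge at
  \<open>s\<close>. Lifting one edge at a time from \<open>x\<close> pulls back a path of length at
  most two.\<close>

lemma within2_pull_back:
  assumes "graph V E" "inj_on k V" "x \<in> V" "y \<in> V" "within2 ((`) k ` E) (k x) (k y)"
  shows "within2 E x y"
proof -
  have pull: "\<exists>t\<in>V. b = k t \<and> {s, t} \<in> E" if "{k s, b} \<in> (`) k ` E" "s \<in> V" for s b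
  proof -
    obtain d where d: "d \<in> E" "{k s, b} = k ` d" using \<open>{k s, b} \<in> (`) k ` E\<close> by blast
    then obtain u v where uv: "d = {u, v}" "u \<in> V" "v \<in> V" using assms(1) by (meson graph_edgeE)
    then have "k s = k u \<and> b = k v \<or> k s = k v \<and> b = k u" using d(2) by (auto simp: doubleton_eq_iff)
    then have "s = u \<and> b = k v \<or> s = v \<and> b = k u" using assms(2) that(2) uv by (auto dest: inj_onD)
    then show ?thesis using d(1) uv by (auto simp: insert_commute)
  qed
  have inj: "k s = k t \<Longrightarrow> s = t" if "s \<in> V" "t \<in> V" for s t using assms(2) that by (auto dest: inj_onD)
  show ?thesis
    using assms(5) unfolding within2_def
  proof (elim disjE exE conjE)
    fix z assume z: "{k x, z} \<in> (`) k ` E" "{z, k y} \<in> (`) k ` E"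
    from pull[OF z(1) assms(3)] obtain t where t: "t \<in> V" "z = k t" "{x, t} \<in> E" by blast
    from pull[OF z(2)[unfolded t(2)] t(1)] obtain s where "s \<in> V" "k y = k s" "{t, s} \<in> E" by blast
    then show "x = y \<or> {x, y} \<in> E \<or> (\<exists>z. {x, z} \<in> E \<and> {z, y} \<in> E)" using t inj assms(4) by blast
  next
    assume "{k x, k y} \<in> (`) k ` E"
    from pull[OF this assms(3)] show "x = y \<or> {x, y} \<in> E \<or> (\<exists>z. {x, z} \<in> E \<and> {z, y} \<in> E)" using inj assms(4) by blast
  qed (use inj assms in blast)
qed

section \<open>Reduced lobes and their pendant vertices\<close>

lemma reduced_graph: "graph V E \<Longrightarrow> graph (reduced_V V E v) (reduced_E V E v)"
  unfolding graph_def reduced_V_def reduced_E_def by fastforce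

lemma pendant_edge:
  assumes "graph V E" "p \<in> pendants_at V E v" "e \<in> E" "p \<in> e"
  shows "e = {v, p}"
proof -
  have "deg E p = 1" "{v, p} \<in> E" using assms(2) by (auto simp: pendants_at_def)
  then obtain d where d: "{e \<in> E. p \<in> e} = {d}" unfolding deg_def by (metis card_1_singletonE)
  have "e \<in> {e \<in> E. p \<in> e}" "{v, p} \<in> {e \<in> E. p \<in> e}" using assms(3,4) \<open>{v, p} \<in> E\<close> by auto
  then show ?thesis unfolding d by simp
qed

text \<open>An edge lost in the reduction contains a pendant vertex, and its only edge goes to
  \<open>v\<close>. So a lobe can be rebuilt by attaching pendant vertices to its reduced
  form.\<close>

lemma reduced_edges:
  assumes "graph V E"
  shows "E = reduced_E V E v \<union> (\<lambda>p. {v, p}) ` pendants_at V E v"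
proof -
  have "e \<in> (\<lambda>p. {v, p}) ` pendants_at V E v" if "e \<in> E" "e \<notin> reduced_E V E v" for e
    using that pendant_edge[OF assms] unfolding reduced_E_def by blast
  then show ?thesis by (auto simp: reduced_E_def pendants_at_def)
qed

lemma root_in_reduced: "graph V E \<Longrightarrow> v \<in> V \<Longrightarrow> v \<in> reduced_V V E v"
  using graph_no_loop[of V E v] by (auto simp: reduced_V_def pendants_at_def)

text \<open>The middle vertex of a path of length two from \<open>v\<close> to some \<open>x\<close>
  other than \<open>v\<close> lies on two edges, so it is not pendant and survives the
  reduction.\<close>

lemma reduced_within2:
  assumes "graph V E" "x \<in> reduced_V V E v" "v \<in> V" "within2 E v x"
  shows "within2 (reduced_E V E v) v x"
proof (cases "x = v")
  case False
  have red: "{a, b} \<in> reduced_E V E v" if "{a, b} \<in> E" "a \<in> reduced_V V E v" "b \<in> reduced_V V E v" for a b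
    using that by (auto simp: reduced_E_def reduced_V_def)
  have v: "v \<in> reduced_V V E v" using root_in_reduced[OF assms(1,3)] .
  show ?thesis
    using assms(4) unfolding within2_def
  proof (elim disjE exE conjE)
    fix z assume z: "{v, z} \<in> E" "{z, x} \<in> E"
    have "z \<notin> pendants_at V E v"
    proof
      assume "z \<in> pendants_at V E v"
      then have "{z, x} = {v, z}" using pendant_edge[OF assms(1) _ z(2)] by blast
      then show False using False by (auto simp: doubleton_eq_iff)
    qed
    then have "z \<in> reduced_V V E v" using graph_pairD[OF assms(1) z(1)] by (simp add: reduced_V_def)
    then show "v = x \<or> {v, x} \<in> reduced_E V E v \<or>
        (\<exists>z. {v, z} \<in> reduced_E V E v \<and> {z, x} \<in> reduced_E V E v)"
      using red z v assms(2) by blast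
  qed (use red v assms(2) in blast)+
qed (simp add: within2_def)

section \<open>The centre of two glued trees\<close>

lemma circ_graph:
  assumes "graph V1 E1" "graph V2 E2" "max_vertex V1 f1 \<in> V1"
  shows "graph (circ_V V1 f1 V2 f2) (circ_E V1 E1 f1 V2 E2 f2)"
  unfolding circ_V_def circ_E_def
  using assms by (intro graph_Un graph_image) (auto simp: inj_on_def glue_map_def split: if_splits)

text \<open>From a vertex off the gluing point, a path of length at most two into the other part
  spends its first edge on reaching the gluing point, so it ends there or at one of its neighbours.
  If all vertices were that close, the other part would be a star, against its diameter.\<close>

lemma circ_center:
  assumes gr: "graph V1 E1" "graph V2 E2"
    and c: "max_vertex V1 f1 \<in> V1" "max_vertex V2 f2 \<in> V2"
    and diam: "diameter V1 E1 > 2" "diameter V2 E2 > 2"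
    and x: "x \<in> circ_V V1 f1 V2 f2"
    and w: "\<And>y. y \<in> circ_V V1 f1 V2 f2 \<Longrightarrow> within2 (circ_E V1 E1 f1 V2 E2 f2) x y"
  shows "x = Inl (max_vertex V1 f1)"
proof (rule ccontr)
  let ?c1 = "max_vertex V1 f1" and ?c2 = "max_vertex V2 f2" and ?E = "circ_E V1 E1 f1 V2 E2 f2"
  assume ne: "x \<noteq> Inl ?c1"
  have edgeD: "(\<exists>u v. {u, v} \<in> E1 \<and> s = {Inl u, Inl v}) \<or>
      (\<exists>u v. {u, v} \<in> E2 \<and> u \<noteq> v \<and> s = {glue_map V1 f1 V2 f2 u, glue_map V1 f1 V2 f2 v})"
    if s: "s \<in> ?E" for s
    using s unfolding circ_E_def
  proof (elim UnE imageE)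
    fix e assume e: "s = Inl ` e" "e \<in> E1"
    then obtain u v where "e = {u, v}" using gr(1) by (meson graph_edgeE)
    then show ?thesis using e by auto
  next
    fix e assume e: "s = glue_map V1 f1 V2 f2 ` e" "e \<in> E2"
    then obtain u v where "e = {u, v}" "u \<noteq> v" using gr(2) by (meson graph_edgeE)
    then show ?thesis using e by auto
  qed
  \<comment> \<open>Only the maximum vertex of the second graph is sent to an \<open>Inl\<close>
    value, and an edge has distinct ends, so every edge between two \<open>Inl\<close> vertices
    comes from \<open>E1\<close>.\<close>
  have LL: "{a, b} \<in> E1" if "{Inl a, Inl b} \<in> ?E" for a b
    using edgeD[OF that]
    by (auto simp: glue_map_def doubleton_eq_iff insert_commute split: if_splits)
  have LR: "a = ?c1 \<and> {?c2, b} \<in> E2" if "{Inl a, Inr b} \<in> ?E" for a b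
    using edgeD[OF that]
    by (auto simp: glue_map_def doubleton_eq_iff insert_commute split: if_splits)
  have RL: "{Inr b, Inl a} \<in> ?E \<Longrightarrow> a = ?c1 \<and> {?c2, b} \<in> E2" for a b
    using LR[of a b] by (simp add: insert_commute)
  have inV: "Inl a \<in> circ_V V1 f1 V2 f2" if "a \<in> V1" for a using that by (simp add: circ_V_def)
  have inV2: "Inr b \<in> circ_V V1 f1 V2 f2" if "b \<in> V2" "b \<noteq> ?c2" for b
    using that by (force simp: circ_V_def glue_map_def)
  show False
  proof (cases x)
    case (Inl a)
    then have a: "a \<noteq> ?c1" using ne by simp
    have "y = ?c2 \<or> {?c2, y} \<in> E2" if y: "y \<in> V2" for y
    proof (rule disjCI)
      assume "\<not> {?c2, y} \<in> E2"
      show "y = ?c2"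
      proof (rule ccontr)
        assume "y \<noteq> ?c2"
        then have "within2 ?E (Inl a) (Inr y)" using w inV2 y Inl by blast
        then obtain z where z: "{Inl a, z} \<in> ?E" "{z, Inr y} \<in> ?E"
          using LR a by (auto simp: within2_def)
        then show False using LR a \<open>\<not> {?c2, y} \<in> E2\<close> by (cases z) blast+
      qed
    qed
    then show False using diameter_star_le_2[OF gr(2) c(2)] diam(2) by fastforce
  next
    case (Inr b)
    have "y = ?c1 \<or> {?c1, y} \<in> E1" if y: "y \<in> V1" for y
    proof (rule disjCI)
      assume "\<not> {?c1, y} \<in> E1"
      show "y = ?c1"
      proof (rule ccontr)
        assume "y \<noteq> ?c1"
        have "within2 ?E (Inr b) (Inl y)" using w inV y Inr by blast
        then obtain z where z: "{Inr b, z} \<in> ?E" "{z, Inl y} \<in> ?E"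
          using RL \<open>y \<noteq> ?c1\<close> by (auto simp: within2_def)
        then show False using LL RL \<open>y \<noteq> ?c1\<close> \<open>\<not> {?c1, y} \<in> E1\<close> by (cases z) blast+
      qed
    qed
    then show False using diameter_star_le_2[OF gr(1) c(1)] diam(1) by fastforce
  qed
qed

text \<open>The isomorphism is not assumed to respect the root. But \<open>v\<close> is within
  distance 2 of the whole lobe, and this passes to its preimage in the glued graph, so
  \<open>circ_center\<close> identifies that preimage as the gluing point. Hence both embedded trees
  are rooted at \<open>v\<close>.\<close>

lemma lobe_embeddings:
  assumes tr: "tree V E" and v: "v \<in> V" "\<And>x. x \<in> V \<Longrightarrow> within2 E v x"
    and gr: "graph V1 E1" "graph V2 E2"
    and c: "max_vertex V1 f1 \<in> V1" "max_vertex V2 f2 \<in> V2"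
    and diam: "diameter V1 E1 > 2" "diameter V2 E2 > 2"
    and iso: "graph_iso (reduced_V V E v) (reduced_E V E v)
      (circ_V V1 f1 V2 f2) (circ_E V1 E1 f1 V2 E2 f2)"
  shows "\<exists>\<phi> \<psi>. inj_on \<phi> V1 \<and> inj_on \<psi> V2 \<and> \<phi> (max_vertex V1 f1) = v \<and> \<psi> (max_vertex V2 f2) = v \<and>
    \<phi> ` V1 \<inter> \<psi> ` V2 = {v} \<and> (\<phi> ` V1 \<union> \<psi> ` V2) \<inter> pendants_at V E v = {} \<and>
    V = \<phi> ` V1 \<union> \<psi> ` V2 \<union> pendants_at V E v \<and>
    E = (`) \<phi> ` E1 \<union> (`) \<psi> ` E2 \<union> (\<lambda>p. {v, p}) ` pendants_at V E v"
proof -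
  let ?C = "circ_V V1 f1 V2 f2" and ?D = "circ_E V1 E1 f1 V2 E2 f2" and ?g = "glue_map V1 f1 V2 f2"
  have grF: "graph V E" using tr by (simp add: tree_def)
  have grC: "graph ?C ?D" using circ_graph[OF gr c(1)] .
  obtain k where k: "bij_betw k ?C (reduced_V V E v)" "reduced_E V E v = (`) k ` ?D"
    using graph_iso_obtain[OF iso reduced_graph[OF grF] grC] .
  have inj: "inj_on k ?C" and img: "k ` ?C = reduced_V V E v" using k(1) by (auto simp: bij_betw_def)
  obtain x where x: "x \<in> ?C" "k x = v" using root_in_reduced[OF grF v(1)] img by (metis imageE)
  have "within2 ?D x y" if y: "y \<in> ?C" for y
  proof -
    have ky: "k y \<in> reduced_V V E v" using img y by blast
    then have "within2 E v (k y)" using v(2) by (simp add: reduced_V_def)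
    then have "within2 (reduced_E V E v) v (k y)" using reduced_within2[OF grF ky v(1)] by simp
    then show ?thesis using within2_pull_back[OF grC inj x(1) y] k(2) x(2) by simp
  qed
  then have xc: "x = Inl (max_vertex V1 f1)" using circ_center[OF gr c diam x(1)] by blast
  have subs: "Inl ` V1 \<subseteq> ?C" "?g ` V2 \<subseteq> ?C" by (auto simp: circ_V_def)
  have injg: "inj_on ?g V2" by (auto simp: inj_on_def glue_map_def split: if_splits)
  have inter: "Inl ` V1 \<inter> ?g ` V2 = {x}"
    using c xc by (auto simp: glue_map_def split: if_splits intro!: rev_image_eqI[of "max_vertex V2 f2"])
  define \<phi> \<psi> where "\<phi> = k \<circ> Inl" and "\<psi> = k \<circ> ?g"
  have "inj_on \<phi> V1" unfolding \<phi>_def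
    using inj subs by (intro comp_inj_on) (auto intro: inj_on_subset)
  moreover have "inj_on \<psi> V2" unfolding \<psi>_def
    using inj subs injg by (intro comp_inj_on) (auto intro: inj_on_subset)
  moreover have "\<phi> (max_vertex V1 f1) = v" "\<psi> (max_vertex V2 f2) = v"
    using x xc by (auto simp: \<phi>_def \<psi>_def glue_map_def)
  moreover have "\<phi> ` V1 \<inter> \<psi> ` V2 = {v}"
    using inj_on_image_Int[OF inj subs] inter x(2) by (simp add: \<phi>_def \<psi>_def image_comp)
  moreover have un: "\<phi> ` V1 \<union> \<psi> ` V2 = reduced_V V E v"
    unfolding \<phi>_def \<psi>_def img[symmetric] circ_V_def by (simp add: image_Un image_comp)
  moreover have "reduced_E V E v = (`) \<phi> ` E1 \<union> (`) \<psi> ` E2"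
    unfolding k(2) circ_E_def \<phi>_def \<psi>_def by (simp add: image_Un image_image image_comp)
  moreover have "reduced_V V E v \<inter> pendants_at V E v = {}"
    "V = reduced_V V E v \<union> pendants_at V E v" by (auto simp: reduced_V_def pendants_at_def)
  ultimately show ?thesis using reduced_edges[OF grF, of v] by metis
qed

text \<open>The preimage of \<open>v\<close> is within distance 2 of every vertex, hence central by
  \<open>central_if_within2\<close>, and the assumption on central vertices makes it
  \<open>c1\<close>.\<close>

lemma last_lobe_embedding:
  assumes tr: "tree V E" and v: "v \<in> V" "\<And>x. x \<in> V \<Longrightarrow> within2 E v x"
    and tr1: "tree V1 E1" and diam: "diameter V1 E1 > 2"
    and c: "\<And>c. central V1 E1 c \<Longrightarrow> c = c1"
    and iso: "graph_iso (reduced_V V E v) (reduced_E V E v) V1 E1"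
  shows "\<exists>\<phi>. inj_on \<phi> V1 \<and> \<phi> c1 = v \<and> \<phi> ` V1 \<inter> pendants_at V E v = {} \<and>
    V = \<phi> ` V1 \<union> pendants_at V E v \<and> E = (`) \<phi> ` E1 \<union> (\<lambda>p. {v, p}) ` pendants_at V E v"
proof -
  have grF: "graph V E" and gr1: "graph V1 E1" using tr tr1 by (auto simp: tree_def)
  obtain k where k: "bij_betw k V1 (reduced_V V E v)" "reduced_E V E v = (`) k ` E1"
    using graph_iso_obtain[OF iso reduced_graph[OF grF] gr1] .
  have inj: "inj_on k V1" and img: "k ` V1 = reduced_V V E v" using k(1) by (auto simp: bij_betw_def)
  obtain x where x: "x \<in> V1" "k x = v" using root_in_reduced[OF grF v(1)] img by (metis imageE)
  have "within2 E1 x y" if y: "y \<in> V1" for y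
  proof -
    have ky: "k y \<in> reduced_V V E v" using img y by blast
    then have "within2 E v (k y)" using v(2) by (simp add: reduced_V_def)
    then have "within2 (reduced_E V E v) v (k y)" using reduced_within2[OF grF ky v(1)] by simp
    then show ?thesis using within2_pull_back[OF gr1 inj x(1) y] k(2) x(2) by simp
  qed
  then have "central V1 E1 x" using central_if_within2[OF tr1 diam x(1)] by blast
  then have "k c1 = v" using c x(2) by blast
  moreover have "reduced_V V E v \<inter> pendants_at V E v = {}"
    "V = reduced_V V E v \<union> pendants_at V E v" by (auto simp: reduced_V_def pendants_at_def)
  ultimately show ?thesis using inj img k(2) reduced_edges[OF grF, of v] by metis
qed

section \<open>Induction along the spine\<close>

theorem theorem4p5:
  fixes V :: "'a set" and E :: "'a set set"
  assumes "lobster V E"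
    and "pairwise_linked V E"
  shows "graceful V E"
proof -
  from assms(2) obtain vs F and G :: "nat \<Rightarrow> nat set \<times> nat set set" and g :: "nat \<Rightarrow> nat \<Rightarrow> nat"
    where desc: "lobster_description V E vs F"
      and G: "\<forall>i < length vs.
             tree (fst (G i)) (snd (G i)) \<and> diameter (fst (G i)) (snd (G i)) = 4 \<and>
             graceful_labeling (fst (G i)) (snd (G i)) (g i) \<and>
             (\<forall>c. central (fst (G i)) (snd (G i)) c \<longrightarrow> g i c = Max (g i ` fst (G i)))"
      and iso: "\<forall>i. Suc i < length vs \<longrightarrow>
             graph_iso (reduced_V (fst (F i)) (snd (F i)) (vs ! i))
                       (reduced_E (fst (F i)) (snd (F i)) (vs ! i))
                       (circ_V (fst (G i)) (g i) (fst (G (Suc i))) (g (Suc i)))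
                       (circ_E (fst (G i)) (snd (G i)) (g i) (fst (G (Suc i))) (snd (G (Suc i))) (g (Suc i)))"
      and iso_last: "let k = length vs - 1 in
             graph_iso (reduced_V (fst (F k)) (snd (F k)) (vs ! k))
                       (reduced_E (fst (F k)) (snd (F k)) (vs ! k))
                       (fst (G k)) (snd (G k))"
    unfolding pairwise_linked_def by blast
  define r where "r = length vs"
  define VF where "VF i = fst (F i)" for i
  define EF where "EF i = snd (F i)" for i
  define VG where "VG i = fst (G i)" for i
  define EG where "EG i = snd (G i)" for i
  define c where "c i = max_vertex (VG i) (g i)" for i
  define v where "v i = vs ! i" for i
  define P where "P i = pendants_at (VF i) (EF i) (v i)" for i
  \<comment> \<open>The first \<open>k\<close> spine edges, ending at \<open>v k\<close>; indices
    start at 0, so the whole spine is \<open>spine (r - 1)\<close>.\<close>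
  define spine where "spine k = {{v i, v (Suc i)} | i. i < k}" for k
  note defs = r_def VF_def EF_def VG_def EG_def v_def
  have r: "0 < r" using desc by (auto simp: lobster_description_def defs)
  have treeF: "tree (VF i) (EF i)" and vF: "v i \<in> VF i" if "i < r" for i
    using desc that by (auto simp: lobster_description_def defs)
  have grF: "graph (VF i) (EF i)" if "i < r" for i using treeF[OF that] by (simp add: tree_def)
  have heightF: "within2 (EF i) (v i) x" if "i < r" "x \<in> VF i" for i x
  proof (rule gdist_le_2D)
    show "connected_graph (VF i) (EF i)" using treeF[OF that(1)] by (simp add: tree_def)
    show "gdist (VF i) (EF i) (v i) x \<le> 2" using desc that by (auto simp: lobster_description_def defs)
  qed (use vF that in auto)
  have disj: "VF i \<inter> VF j = {}" if "i < r" "j < r" "i \<noteq> j" for i j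
    using desc that by (auto simp: lobster_description_def defs)
  have V_eq: "V = (\<Union>i<r. VF i)"
  proof -
    have "V = set vs \<union> (\<Union>i<r. VF i)" using desc by (auto simp: lobster_description_def defs)
    moreover have "set vs \<subseteq> (\<Union>i<r. VF i)" using vF by (force simp: in_set_conv_nth r_def v_def)
    ultimately show ?thesis by blast
  qed
  have "E = {{vs ! i, vs ! Suc i} | i. Suc i < length vs} \<union> (\<Union>i < length vs. snd (F i))"
    using desc unfolding lobster_description_def by blast
  moreover have "{{vs ! i, vs ! Suc i} | i. Suc i < length vs} = spine (r - 1)"
    by (auto simp: spine_def defs less_diff_conv)
  ultimately have E_eq: "E = spine (r - 1) \<union> (\<Union>i<r. EF i)" by (simp add: defs)
  have treeG: "tree (VG i) (EG i)" and diamG: "diameter (VG i) (EG i) > 2" if "i < r" for i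
    using G that by (auto simp: defs)
  have grG: "graph (VG i) (EG i)" and neG: "VG i \<noteq> {}" if "i < r" for i
    using treeG[OF that] by (auto simp: tree_def)
  have topG: "top_graceful (VG i) (EG i) (c i) (g i) (card (EG i))" if "i < r" for i
    unfolding c_def using G that by (intro graceful_labeling_top grG neG) (auto simp: defs)
  have cG: "c i \<in> VG i" if "i < r" for i using topG[OF that] by (simp add: top_graceful_def)
  \<comment> \<open>Both vertices carry the maximum label, and the labeling is injective.\<close>
  have centralG: "x = c i" if i: "i < r" and x: "central (VG i) (EG i) x" for i x
  proof -
    have "g i x = Max (g i ` VG i)" using G i x by (auto simp: defs)
    moreover have "g i (c i) \<le> Max (g i ` VG i)"
      using cG[OF i] grG[OF i] by (auto simp: graph_def)
    moreover have "g i x \<le> g i (c i)" and "x \<in> VG i" and "inj_on (g i) (VG i)"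
      using topG[OF i] x by (auto simp: top_graceful_def central_def)
    ultimately show ?thesis using cG[OF i] by (metis inj_onD le_antisym)
  qed
  \<comment> \<open>Lobe \<open>i\<close> consists of a copy of tree \<open>i\<close> under \<phi>,
    a copy of tree \<open>Suc i\<close> under \<psi>, and pendant vertices. Thus tree
    \<open>Suc i\<close> appears in the two consecutive lobes \<open>i\<close> and
    \<open>Suc i\<close>, with roots joined by a spine edge: the two copies that the linking lemma
    adds.\<close>
  define Q where "Q i \<phi> \<psi> \<longleftrightarrow> inj_on \<phi> (VG i) \<and> inj_on \<psi> (VG (Suc i)) \<and> \<phi> (c i) = v i \<and> \<psi> (c (Suc i)) = v i \<and>
    \<phi> ` VG i \<inter> \<psi> ` VG (Suc i) = {v i} \<and> (\<phi> ` VG i \<union> \<psi> ` VG (Suc i)) \<inter> P i = {} \<and>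
    VF i = \<phi> ` VG i \<union> \<psi> ` VG (Suc i) \<union> P i \<and>
    EF i = (`) \<phi> ` EG i \<union> (`) \<psi> ` EG (Suc i) \<union> (\<lambda>p. {v i, p}) ` P i" for i \<phi> \<psi>
  have "\<exists>\<phi> \<psi>. Q i \<phi> \<psi>" if Si: "Suc i < r" for i
  proof -
    have i: "i < r" using Si by simp
    have "graph_iso (reduced_V (VF i) (EF i) (v i)) (reduced_E (VF i) (EF i) (v i))
      (circ_V (VG i) (g i) (VG (Suc i)) (g (Suc i)))
      (circ_E (VG i) (EG i) (g i) (VG (Suc i)) (EG (Suc i)) (g (Suc i)))"
      using iso Si by (simp add: defs)
    from lobe_embeddings[OF treeF[OF i] vF[OF i] heightF[OF i] grG[OF i] grG[OF Si]
        cG[OF i, unfolded c_def] cG[OF Si, unfolded c_def] diamG[OF i] diamG[OF Si] this]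
    show ?thesis unfolding Q_def c_def P_def .
  qed
  then obtain \<phi>' \<psi> where "\<And>i. Suc i < r \<Longrightarrow> Q i (\<phi>' i) (\<psi> i)" by metis
  note pair = this[unfolded Q_def]
  define l where "l = r - 1"
  have l: "l < r" "Suc l = r" using r by (auto simp: l_def)
  have "graph_iso (reduced_V (VF l) (EF l) (v l)) (reduced_E (VF l) (EF l) (v l)) (VG l) (EG l)"
    using iso_last by (simp add: defs l_def Let_def)
  from last_lobe_embedding[OF treeF[OF l(1)] vF[OF l(1)] heightF[OF l(1)] treeG[OF l(1)] diamG[OF l(1)]
      centralG[OF l(1)] this]
  have "\<exists>\<phi>l. inj_on \<phi>l (VG l) \<and> \<phi>l (c l) = v l \<and> \<phi>l ` VG l \<inter> P l = {} \<and>
    VF l = \<phi>l ` VG l \<union> P l \<and> EF l = (`) \<phi>l ` EG l \<union> (\<lambda>p. {v l, p}) ` P l"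
    unfolding P_def .
  then obtain \<phi>l where last: "inj_on \<phi>l (VG l)" "\<phi>l (c l) = v l" "\<phi>l ` VG l \<inter> P l = {}"
    "VF l = \<phi>l ` VG l \<union> P l" "EF l = (`) \<phi>l ` EG l \<union> (\<lambda>p. {v l, p}) ` P l"
    by (elim exE conjE)
  \<comment> \<open>The last lobe contains one tree only and has its own embedding; merging it into
    the family lets every lobe be treated uniformly.\<close>
  define \<phi> where "\<phi> i = (if i = l then \<phi>l else \<phi>' i)" for i
  have pair\<phi>: "\<phi> i = \<phi>' i" if "Suc i < r" for i using that l by (auto simp: \<phi>_def)
  have last\<phi>: "\<phi> l = \<phi>l" by (simp add: \<phi>_def)
  have il: "i = l \<or> Suc i < r" if "i < r" for i using that l by auto
  have \<phi>: "inj_on (\<phi> i) (VG i)" "\<phi> i (c i) = v i" "\<phi> i ` VG i \<inter> P i = {}" "\<phi> i ` VG i \<subseteq> VF i"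
    "(`) (\<phi> i) ` EG i \<subseteq> EF i" if i: "i < r" for i
  proof -
    have "inj_on (\<phi> i) (VG i) \<and> \<phi> i (c i) = v i \<and> \<phi> i ` VG i \<inter> P i = {} \<and> \<phi> i ` VG i \<subseteq> VF i \<and>
      (`) (\<phi> i) ` EG i \<subseteq> EF i"
    proof (cases "i = l")
      case True
      then show ?thesis using last last\<phi> by simp
    next
      case False
      then have "Suc i < r" using il[OF i] by simp
      then show ?thesis using pair[of i] pair\<phi>[of i] by (simp add: Int_Un_distrib2 sup.coboundedI1)
    qed
    then show "inj_on (\<phi> i) (VG i)" "\<phi> i (c i) = v i" "\<phi> i ` VG i \<inter> P i = {}" "\<phi> i ` VG i \<subseteq> VF i"
      "(`) (\<phi> i) ` EG i \<subseteq> EF i" by blast+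
  qed
  have finP: "finite (P i)" and PF: "P i \<subseteq> VF i" if "i < r" for i
    using grF[OF that] by (auto simp: P_def pendants_at_def graph_def)
  \<comment> \<open>Stage \<open>k\<close> comprises all earlier lobes in full, the spine up to
    \<open>v k\<close>, and from lobe \<open>k\<close> only the copy of tree \<open>k\<close>. The
    pendant vertices at \<open>v k\<close> and the second copy there are still missing.\<close>
  define W where "W k = (\<Union>i<k. VF i) \<union> \<phi> k ` VG k" for k
  define D where "D k = (\<Union>i<k. EF i) \<union> (`) (\<phi> k) ` EG k \<union> spine k" for k
  have PW: "P k \<inter> W k = {}" if k: "k < r" for k
  proof -
    have "VF k \<inter> VF i = {}" if "i < k" for i using disj[of k i] that k by simp
    then show ?thesis unfolding W_def using \<phi>(3)[OF k] PF[OF k] by blast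
  qed
  have "\<exists>f n. top_graceful (W k) (D k) (v k) f n" if "k < r" for k
    using that
  proof (induction k)
    case 0
    obtain f where "top_graceful (\<phi> 0 ` VG 0) ((`) (\<phi> 0) ` EG 0) (\<phi> 0 (c 0)) f (card (EG 0))"
      using top_graceful_image[OF topG[OF r] \<phi>(1)[OF r]] by blast
    then have "top_graceful (W 0) (D 0) (v 0) f (card (EG 0))"
      using \<phi>(2)[OF r] by (simp add: W_def D_def spine_def)
    then show ?case by blast
  next
    case (Suc k)
    then have k: "k < r" and Sk: "Suc k < r" by auto
    have inj\<psi>: "inj_on (\<psi> k) (VG (Suc k))" and \<psi>c: "\<psi> k (c (Suc k)) = v k"
      and \<phi>\<psi>: "\<phi> k ` VG k \<inter> \<psi> k ` VG (Suc k) = {v k}" and disjP: "(\<phi> k ` VG k \<union> \<psi> k ` VG (Suc k)) \<inter> P k = {}"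
      and VFk: "VF k = \<phi> k ` VG k \<union> \<psi> k ` VG (Suc k) \<union> P k"
      and EFk: "EF k = (`) (\<phi> k) ` EG k \<union> (`) (\<psi> k) ` EG (Suc k) \<union> (\<lambda>p. {v k, p}) ` P k"
      using pair[OF Sk, folded pair\<phi>[OF Sk]] by - (elim conjE, assumption)+
    \<comment> \<open>The pendant vertices at \<open>v k\<close> have to be attached now, while
      \<open>v k\<close> still carries the maximum label.\<close>
    obtain f n where H: "top_graceful (W k \<union> P k) (D k \<union> (\<lambda>p. {v k, p}) ` P k) (v k) f n"
      using top_graceful_add_pendants[OF finP[OF k] Suc.IH[OF k] PW[OF k]] by blast
    \<comment> \<open>The colour class is read off in the lobe, where the root is known to reach
      everything within distance 2, and pulled back to the tree along \<phi>.\<close>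
    define B where "B = {y. {v (Suc k), \<phi> (Suc k) y} \<in> EF (Suc k)}"
    have bip: "\<exists>a b. e = {a, b} \<and> a \<notin> B \<and> b \<in> B" if e: "e \<in> EG (Suc k)" for e
    proof -
      obtain x y where xy: "e = {x, y}" using grG[OF Sk] e by (meson graph_edgeE)
      have "\<phi> (Suc k) ` e \<in> EF (Suc k)" using \<phi>(5)[OF Sk] e by blast
      then obtain a b where "\<phi> (Suc k) ` e = {a, b}" "{v (Suc k), a} \<notin> EF (Suc k)" "{v (Suc k), b} \<in> EF (Suc k)"
        using tree_height2_bipartite[OF treeF[OF Sk] vF[OF Sk] heightF[OF Sk]] by blast
      then have "x \<notin> B \<and> y \<in> B \<or> y \<notin> B \<and> x \<in> B"
        unfolding B_def xy by (auto simp: doubleton_eq_iff)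
      then show ?thesis using xy by (metis insert_commute)
    qed
    have cB: "c (Suc k) \<notin> B" using \<phi>(2)[OF Sk] graph_no_loop[OF grF[OF Sk]] by (simp add: B_def)
    have before: "VF k \<inter> VF i = {}" if "i < k" for i using disj[of k i] that k by simp
    have "\<psi> k ` VG (Suc k) \<inter> (\<Union>i<k. VF i) = {}" using VFk before by fastforce
    \<comment> \<open>The second copy in lobe \<open>k\<close> avoids the earlier lobes and the
      pendant vertices, and meets the first copy only in the root.\<close>
    then have h1: "\<psi> k ` VG (Suc k) \<inter> (W k \<union> P k) = {v k}"
      unfolding W_def using \<phi>\<psi> disjP by (simp add: Int_Un_distrib Int_Un_distrib2 Int_commute)
    have "VF (Suc k) \<inter> VF i = {}" if "i < Suc k" for i using disj[of "Suc k" i] that Sk by simp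
    then have "VF (Suc k) \<inter> (\<Union>i<Suc k. VF i) = {}" by (simp only: Int_UN_distrib lessThan_iff) simp
    moreover have "W k \<union> P k \<union> \<psi> k ` VG (Suc k) = (\<Union>i<Suc k. VF i)"
      unfolding W_def lessThan_Suc by (simp add: VFk Un_ac)
    ultimately have h2: "\<phi> (Suc k) ` VG (Suc k) \<inter> (W k \<union> P k \<union> \<psi> k ` VG (Suc k)) = {}"
      using \<phi>(4)[OF Sk] by (metis Int_mono order_refl subset_empty)
    have "\<exists>f n. top_graceful (W k \<union> P k \<union> \<psi> k ` VG (Suc k) \<union> \<phi> (Suc k) ` VG (Suc k))
      (D k \<union> (\<lambda>p. {v k, p}) ` P k \<union> (`) (\<psi> k) ` EG (Suc k) \<union> (`) (\<phi> (Suc k)) ` EG (Suc k) \<union>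
        {{v k, \<phi> (Suc k) (c (Suc k))}}) (\<phi> (Suc k) (c (Suc k))) f n"
      using top_graceful_link_copies[OF H topG[OF Sk] bip cB, of "\<psi> k" "\<phi> (Suc k)"] inj\<psi> \<psi>c h1 h2 \<phi>(1)[OF Sk]
      by blast
    moreover have "W k \<union> P k \<union> \<psi> k ` VG (Suc k) \<union> \<phi> (Suc k) ` VG (Suc k) = W (Suc k)"
      unfolding W_def lessThan_Suc by (simp add: VFk Un_ac)
    moreover have "spine (Suc k) = spine k \<union> {{v k, v (Suc k)}}"
      by (auto simp: spine_def less_Suc_eq)
    then have "D k \<union> (\<lambda>p. {v k, p}) ` P k \<union> (`) (\<psi> k) ` EG (Suc k) \<union> (`) (\<phi> (Suc k)) ` EG (Suc k) \<union>
        {{v k, \<phi> (Suc k) (c (Suc k))}} = D (Suc k)"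
      unfolding D_def lessThan_Suc using \<phi>(2)[OF Sk] by (simp add: EFk Un_ac)
    ultimately show ?case using \<phi>(2)[OF Sk] by simp
  qed
  \<comment> \<open>At the last stage only the pendant vertices of the last spine vertex remain to
    be attached.\<close>
  from top_graceful_add_pendants[OF finP[OF l(1)] this[OF l(1)] PW[OF l(1)]]
  obtain f n where "top_graceful (W l \<union> P l) (D l \<union> (\<lambda>p. {v l, p}) ` P l) (v l) f n" by blast
  moreover have "{..<r} = insert l {..<l}" using l by auto
  then have "W l \<union> P l = V" "D l \<union> (\<lambda>p. {v l, p}) ` P l = E"
    unfolding W_def D_def V_eq E_eq l_def[symmetric] using last last\<phi> by auto
  ultimately show ?thesis by (metis top_graceful_imp_graceful)
qed

end
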